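(* Let $p\geq 5$ be a prime and let $s$ be any nonnegative integer. If $B$ is a positive integer such that $p\nmid B$ and $p^{2s+1}B\equiv 1\pmod{48}$, then $$DSOME\left(\frac{p^{2s+1}B-1}{24}\right)\equiv 0\pmod 4.$$
   Context: $DSOME(n)$ denotes the sum of all the odd parts in all the partitions of $n$ into distinct parts minus the sum of all the even parts in all those same partitions, with $DSOME(0)=0$. Equivalently, $\sum_{n\ge 0}DSOME(n)q^n=\prod_{j\ge1}(1+q^j)\cdot\sum_{m\ge 1}\frac{(-1)^{m-1}q^m}{(1+q^m)^2}$. *)

theory Defs
  imports "HOL-Number_Theory.Number_Theory"
begin

text \<open>A partition into distinct parts is determined by its set of parts, a finite set of positive
  integers. The empty set is the unique such partition of 0.\<close>

definition distinct_partitions :: "nat \<Rightarrow> nat set set" where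
  "distinct_partitions n = {P. finite P \<and> 0 \<notin> P \<and> \<Sum>P = n}"

text \<open>The sum defining \<open>DSOME\<close> is over a finite set, so it is not zero by default.\<close>

lemma finite_distinct_partitions: "finite (distinct_partitions n)"
proof (rule finite_subset)
  show "distinct_partitions n \<subseteq> Pow {..n}"
    by (auto simp: distinct_partitions_def intro: member_le_sum[where f = "\<lambda>x. x", simplified])
qed simp

definition DSOME :: "nat \<Rightarrow> int" where
  "DSOME n = (\<Sum>P\<in>distinct_partitions n. \<Sum>k | k \<in> P \<and> odd k. int k)
           - (\<Sum>P\<in>distinct_partitions n. \<Sum>k | k \<in> P \<and> even k. int k)"

lemma DSOME_0: "DSOME 0 = 0"
proof -
  have "distinct_partitions 0 = {{}}"
    by (auto simp: distinct_partitions_def)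
  then show ?thesis
    by (simp add: DSOME_def)
qed

end

theory Submission
  imports Defs "HOL-Computational_Algebra.Polynomial"
begin

text \<open>Replacing the sign of an even part changes a sum by twice that part, a multiple of 4. Hence
  \<open>DSOME n\<close> agrees modulo 4 with the sum of all parts of all partitions of \<open>n\<close> into distinct parts,
  which is \<open>n\<close> times the number of those partitions. In the theorem
  \<open>24 * n + 1 = p ^ (2 * s + 1) * B\<close> is \<open>1\<close> modulo 48, so \<open>n\<close> is even, and it suffices that
  the number of partitions is even as well.

  Modulo 2 this number is the coefficient of \<open>x ^ n\<close> in the Euler product of the factors
  \<open>1 - x ^ j\<close>. By the pentagonal number theorem this coefficient vanishes unless
  \<open>n = k * (3 * k \<plusminus> 1) / 2\<close> for some \<open>k\<close>, which amounts to \<open>24 * n + 1 = (6 * k \<plusminus> 1)\<^sup>2\<close>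
  being a square (lemma \<open>even_card_distinct_partitions\<close>). But \<open>p\<close> divides
  \<open>p ^ (2 * s + 1) * B\<close> to the odd power \<open>2 * s + 1\<close>, so \<open>24 * n + 1\<close> is not a square.

  The pentagonal number theorem is obtained from an identity of Shanks between finite sums
  (lemma \<open>shanks_identity\<close>). It holds in every commutative ring and has a short proof by induction,
  in which the difference of consecutive left-hand sides telescopes.\<close>

text \<open>The summands of the left-hand side of Shanks' identity. The summand for \<open>s = 0\<close> is the
  truncated Euler product; every other one is divisible by \<open>x ^ Suc n\<close>, so it does not affect the
  coefficients up to \<open>x ^ n\<close>.\<close>

definition shanks_term :: "'a::comm_ring_1 \<Rightarrow> nat \<Rightarrow> nat \<Rightarrow> 'a" where
  "shanks_term x n s = (-1) ^ s * (\<Prod>j\<in>{s<..n}. 1 - x ^ j) * x ^ (s * Suc n + \<Sum>{..<s})"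

text \<open>Passing from \<open>n\<close> to \<open>Suc n\<close> multiplies the product in \<open>shanks_term x n s\<close> by
  \<open>1 - x ^ Suc n\<close> and the power by \<open>x ^ s\<close>. Writing
  \<open>x ^ s * (1 - x ^ Suc n) - 1 = - (1 - x ^ s) - x ^ (s + Suc n)\<close>, the factor \<open>1 - x ^ s\<close> enlarges
  the product to the one that belongs to \<open>s - 1\<close>, and the two resulting pieces cancel between
  neighbouring values of \<open>s\<close>.\<close>

lemma sum_shanks_term_difference:
  fixes x :: "'a::comm_ring_1"
  assumes "k \<le> n"
  shows "(\<Sum>s\<le>k. shanks_term x (Suc n) s - shanks_term x n s)
    = (-1) ^ Suc k * (\<Prod>j\<in>{k<..n}. 1 - x ^ j) * x ^ (Suc k * Suc n + \<Sum>{..<Suc k})"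
  using assms
proof (induction k)
  case 0
  have "{0<..Suc n} = insert (Suc n) {0<..n}" by auto
  then show ?case
    by (simp add: shanks_term_def algebra_simps)
next
  case (Suc k)
  define A where "A = (\<Prod>j\<in>{Suc k<..n}. 1 - x ^ j)"
  define y where "y = x ^ (Suc k * Suc n + \<Sum>{..<Suc k})"
  have "{k<..n} = insert (Suc k) {Suc k<..n}" using Suc.prems by auto
  then have lower: "(\<Prod>j\<in>{k<..n}. 1 - x ^ j) = (1 - x ^ Suc k) * A"
    by (simp add: A_def)
  have "{Suc k<..Suc n} = insert (Suc n) {Suc k<..n}" using Suc.prems by auto
  then have upper: "(\<Prod>j\<in>{Suc k<..Suc n}. 1 - x ^ j) = (1 - x ^ Suc n) * A"
    by (simp add: A_def)
  have "Suc k * Suc (Suc n) + \<Sum>{..<Suc k} = (Suc k * Suc n + \<Sum>{..<Suc k}) + Suc k"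
    by simp
  then have pow1: "x ^ (Suc k * Suc (Suc n) + \<Sum>{..<Suc k}) = y * x ^ Suc k"
    unfolding y_def by (metis power_add)
  have "Suc (Suc k) * Suc n + \<Sum>{..<Suc (Suc k)} = (Suc k * Suc n + \<Sum>{..<Suc k}) + Suc k + Suc n"
    by simp
  then have pow2: "x ^ (Suc (Suc k) * Suc n + \<Sum>{..<Suc (Suc k)}) = y * x ^ Suc k * x ^ Suc n"
    unfolding y_def by (metis power_add)
  define u v e where "u = x ^ Suc k" and "v = x ^ Suc n" and "e = (-1::'a) ^ Suc k"
  have "(\<Sum>s\<le>Suc k. shanks_term x (Suc n) s - shanks_term x n s)
      = e * ((1 - u) * A) * y + (e * ((1 - v) * A) * (y * u) - e * A * y)"
    using Suc.IH Suc.prems unfolding sum.atMost_Suc shanks_term_def pow1 lower upper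
    by (simp add: A_def y_def u_def v_def e_def)
  also have "\<dots> = - e * A * (y * u * v)"
    by (simp add: algebra_simps)
  also have "\<dots> = (-1) ^ Suc (Suc k) * A * x ^ (Suc (Suc k) * Suc n + \<Sum>{..<Suc (Suc k)})"
    unfolding pow2 by (simp add: u_def v_def e_def)
  finally show ?case by (simp only: A_def)
qed

text \<open>The exponents on the right are the generalized pentagonal numbers \<open>k * (3 * k - 1) / 2\<close> and
  \<open>k * (3 * k + 1) / 2\<close>. In the induction step the first one is the end of the telescoping sum and
  the second one is the new summand \<open>shanks_term x (Suc n) (Suc n)\<close>.\<close>

lemma shanks_identity:
  fixes x :: "'a::comm_ring_1"
  shows "(\<Sum>s\<le>n. shanks_term x n s)
    = 1 + (\<Sum>k=1..n. (-1) ^ k * (x ^ (k * k + \<Sum>{..<k}) + x ^ (k * k + k + \<Sum>{..<k})))"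
proof (induction n)
  case 0
  show ?case by (simp add: shanks_term_def)
next
  case (Suc n)
  have "(\<Sum>s\<le>Suc n. shanks_term x (Suc n) s)
      = (\<Sum>s\<le>n. shanks_term x n s) + (\<Sum>s\<le>n. shanks_term x (Suc n) s - shanks_term x n s)
        + shanks_term x (Suc n) (Suc n)"
    by (simp add: sum_subtractf)
  also have "(\<Sum>s\<le>n. shanks_term x (Suc n) s - shanks_term x n s)
      = (-1) ^ Suc n * x ^ (Suc n * Suc n + \<Sum>{..<Suc n})"
    by (subst sum_shanks_term_difference) simp_all
  also have "shanks_term x (Suc n) (Suc n)
      = (-1) ^ Suc n * x ^ (Suc n * Suc n + Suc n + \<Sum>{..<Suc n})"
    by (simp add: shanks_term_def algebra_simps)
  finally show ?case
    unfolding Suc.IH by (simp add: algebra_simps)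
qed

lemma prod_one_minus_power_expand:
  fixes x :: "'a::comm_ring_1"
  assumes "finite A"
  shows "(\<Prod>j\<in>A. 1 - x ^ j) = (\<Sum>P\<in>Pow A. (-1) ^ card P * x ^ \<Sum>P)"
  using assms
proof (induction A)
  case empty
  then show ?case by simp
next
  case (insert a A)
  have fin: "finite P" "a \<notin> P" if "P \<in> Pow A" for P
    using that insert.hyps by (auto intro: finite_subset)
  have "inj_on (insert a) (Pow A)" "Pow A \<inter> insert a ` Pow A = {}"
    using insert.hyps by (auto simp: inj_on_def)
  then have "(\<Sum>P\<in>Pow (insert a A). (-1) ^ card P * x ^ \<Sum>P)
      = (\<Sum>P\<in>Pow A. (-1) ^ card P * x ^ \<Sum>P)
        + (\<Sum>P\<in>Pow A. (-1) ^ card (insert a P) * x ^ \<Sum>(insert a P))"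
    using insert.hyps by (simp add: Pow_insert sum.union_disjoint sum.reindex)
  also have "(\<Sum>P\<in>Pow A. (-1) ^ card (insert a P) * x ^ \<Sum>(insert a P))
      = - (x ^ a) * (\<Sum>P\<in>Pow A. (-1) ^ card P * x ^ \<Sum>P)"
    unfolding sum_distrib_left
    by (rule sum.cong) (use fin in \<open>simp_all add: power_add algebra_simps\<close>)
  finally show ?case
    using insert by (simp add: algebra_simps)
qed

lemma distinct_partitions_eq: "distinct_partitions n = {P \<in> Pow {0<..n}. \<Sum>P = n}"
proof -
  have "k \<le> \<Sum>P" if "finite P" "k \<in> P" for k and P :: "nat set"
    using that by (intro member_le_sum[where f = "\<lambda>x. x", simplified]) simp_all
  then have "P \<subseteq> {0<..\<Sum>P}" if "finite P" "0 \<notin> P" for P :: "nat set"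
    using that by (metis greaterThanAtMost_iff gr0I subsetI)
  moreover have "finite P" if "P \<subseteq> {0<..n}" for P
    using that finite_subset by blast
  ultimately show ?thesis
    unfolding distinct_partitions_def
    by (intro Collect_cong) (simp, metis greaterThanAtMost_iff less_irrefl subsetD)
qed

text \<open>Shanks' identity at the polynomial variable \<open>x\<close> computes the coefficient of \<open>x ^ n\<close> in the
  Euler product, which is the number of partitions of \<open>n\<close> into distinct parts, each counted with
  a sign. Signs do not matter for parity.\<close>

lemma even_card_distinct_partitions:
  assumes nonsquare: "\<And>a::nat. 24 * n + 1 \<noteq> a\<^sup>2"
  shows "even (card (distinct_partitions n))"
proof -
  define x :: "int poly" where "x = monom 1 1"
  have x_pow: "x ^ k = monom 1 k" for k
    by (simp add: x_def monom_power)
  have tri: "2 * \<Sum>{..<k} + k = k * k" for k :: nat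
    by (induction k) simp_all
  have coeff_sign: "coeff ((-1) ^ k * q) n = (-1) ^ k * coeff q n" for k and q :: "int poly"
    by (cases "even k") simp_all
  have "coeff (\<Sum>s\<le>n. shanks_term x n s) n = coeff (shanks_term x n 0) n"
  proof -
    have "coeff (shanks_term x n s) n = 0" if "s \<noteq> 0" for s
    proof -
      have "n < s * Suc n + \<Sum>{..<s}"
        using that by (cases s) auto
      then show ?thesis
        unfolding shanks_term_def x_pow by (subst mult.commute) (simp add: coeff_monom_mult)
    qed
    then show ?thesis
      by (simp add: coeff_sum sum.remove[where x = 0])
  qed
  also have "shanks_term x n 0 = (\<Sum>P\<in>Pow {0<..n}. (-1) ^ card P * x ^ \<Sum>P)"
    by (simp add: shanks_term_def prod_one_minus_power_expand)
  also have "coeff \<dots> n = (\<Sum>P\<in>Pow {0<..n}. if \<Sum>P = n then (-1) ^ card P else 0)"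
    unfolding coeff_sum coeff_sign x_pow by (intro sum.cong) simp_all
  also have "\<dots> = (\<Sum>P\<in>distinct_partitions n. (-1) ^ card P)"
    unfolding distinct_partitions_eq by (rule sum.inter_filter[symmetric]) simp
  finally have signed_count:
    "coeff (\<Sum>s\<le>n. shanks_term x n s) n = (\<Sum>P\<in>distinct_partitions n. (-1) ^ card P)" .
  have "coeff (\<Sum>s\<le>n. shanks_term x n s) n = 0"
  proof -
    have "n \<noteq> 0"
      using nonsquare[of 1] by auto
    moreover have "k * k + \<Sum>{..<k} \<noteq> n" if k: "k \<ge> 1" for k
    proof
      assume "k * k + \<Sum>{..<k} = n"
      then have "24 * n + 12 * k = 36 * (k * k)"
        using tri[of k] by simp
      then have "int (24 * n + 12 * k) = int (36 * (k * k))"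
        by (simp only: of_nat_eq_iff)
      then have "int (24 * n + 1) = (6 * int k - 1)\<^sup>2"
        by (simp add: power2_eq_square algebra_simps)
      also have "\<dots> = int ((6 * k - 1)\<^sup>2)"
        using k by (simp add: of_nat_diff)
      finally show False
        using nonsquare[of "6 * k - 1"] by (simp only: of_nat_eq_iff)
    qed
    moreover have "k * k + k + \<Sum>{..<k} \<noteq> n" for k
    proof
      assume "k * k + k + \<Sum>{..<k} = n"
      then have "24 * n = 36 * (k * k) + 12 * k"
        using tri[of k] by simp
      then have "24 * n + 1 = (6 * k + 1)\<^sup>2"
        by (simp add: power2_eq_square algebra_simps)
      then show False using nonsquare by blast
    qed
    ultimately show ?thesis
      unfolding shanks_identity coeff_add coeff_sum coeff_sign x_pow
      by (simp cong: sum.cong_simp)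
  qed
  then have "even (\<Sum>P\<in>distinct_partitions n. (-1::int) ^ card P)"
    using signed_count by simp
  then show ?thesis
    by (simp add: even_sum_iff finite_distinct_partitions)
qed

lemma DSOME_cong_mult_card:
  "[DSOME n = int n * int (card (distinct_partitions n))] (mod 4)"
proof -
  let ?D = "distinct_partitions n"
  define E where "E = (\<Sum>P\<in>?D. \<Sum>k | k \<in> P \<and> even k. int k)"
  have "(\<Sum>k | k \<in> P \<and> odd k. int k) + (\<Sum>k | k \<in> P \<and> even k. int k) = int n"
    if "P \<in> ?D" for P
  proof -
    have "finite P" "\<Sum>P = n" using that by (auto simp: distinct_partitions_def)
    have "(\<Sum>k | k \<in> P \<and> odd k. int k) + (\<Sum>k | k \<in> P \<and> even k. int k) = (\<Sum>k\<in>P. int k)"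
      using \<open>finite P\<close> by (subst sum.union_disjoint[symmetric]) (auto intro: sum.cong)
    then show ?thesis
      using \<open>\<Sum>P = n\<close> by (simp flip: of_nat_sum)
  qed
  then have "(\<Sum>P\<in>?D. \<Sum>k | k \<in> P \<and> odd k. int k) + E = int n * int (card ?D)"
    unfolding E_def by (simp flip: sum.distrib)
  then have "DSOME n = int n * int (card ?D) - 2 * E"
    by (simp add: DSOME_def E_def)
  moreover have "even E"
    unfolding E_def by (intro dvd_sum) auto
  ultimately show ?thesis
    by (auto simp: cong_iff_dvd_diff elim!: evenE)
qed

lemma prime_odd_power_mult_not_square:
  fixes p s B a :: nat
  assumes "prime p" "\<not> p dvd B"
  shows "p ^ (2 * s + 1) * B \<noteq> a\<^sup>2"
proof
  assume eq: "p ^ (2 * s + 1) * B = a\<^sup>2"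
  moreover have "p ^ (2 * s + 1) * B \<noteq> 0"
    using assms by (cases "B = 0") auto
  ultimately have "a \<noteq> 0"
    by auto
  then have "multiplicity p (a\<^sup>2) = 2 * multiplicity p a"
    using assms(1) by (simp add: prime_elem_multiplicity_power_distrib)
  moreover have "multiplicity p (p ^ (2 * s + 1) * B) = 2 * s + 1"
    using assms by (intro multiplicity_eqI) auto
  ultimately show False
    unfolding eq by presburger
qed

theorem corollary4p8:
  fixes p s B :: nat
  assumes "prime p" and "p \<ge> 5"
    and "B > 0" and "\<not> p dvd B"
    and "[p ^ (2 * s + 1) * B = 1] (mod 48)"
  shows "[DSOME ((p ^ (2 * s + 1) * B - 1) div 24) = 0] (mod 4)"
proof -
  define n where "n = (p ^ (2 * s + 1) * B - 1) div 24"
  have "(p ^ (2 * s + 1) * B) mod 48 = 1"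
    using assms(5) by (simp add: cong_def)
  then obtain q where q: "p ^ (2 * s + 1) * B = 48 * q + 1"
    by (metis mod_mult_div_eq add.commute)
  then have "n = 2 * q"
    by (simp add: n_def del: power_Suc)
  with q have n: "24 * n + 1 = p ^ (2 * s + 1) * B" and "even n"
    by simp_all
  have "even (card (distinct_partitions n))"
    using prime_odd_power_mult_not_square[OF assms(1,4)] n
    by (intro even_card_distinct_partitions) metis
  with \<open>even n\<close> have "4 dvd int n * int (card (distinct_partitions n))"
    by (auto elim!: evenE)
  then have "[int n * int (card (distinct_partitions n)) = 0] (mod 4)"
    by (simp add: cong_0_iff)
  with DSOME_cong_mult_card have "[DSOME n = 0] (mod 4)"
    by (rule cong_trans)
  then show ?thesis by (simp only: n_def)
qed

end
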